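(* For the problem of minimizing makespan for online job scheduling on two uniformly related machines, $\textsc{Greedy}$ has online bounded ratio $1$.
   Context: There are two machines, machine 1 with speed $s>1$ and machine 2 with speed $1$. Jobs with positive sizes arrive online and each must be assigned irrevocably to one machine; the completion time of a machine is the total size of its jobs divided by its speed, and the makespan is the maximum completion time; the goal is to minimize the makespan. $\textsc{Greedy}$ assigns the current job to the machine for which the resulting makespan is smaller, breaking ties in favor of the slower machine (machine 2). For a deterministic online algorithm $A$ of a minimization problem, $\textsc{Opt}_A$ denotes an offline algorithm that is optimal among offline algorithms whose solution on any input $I$ satisfies, for every prefix $I'$ of $I$, that the cost of the solution restricted to $I'$ is at most $A(I')$. The online bounded ratio of $A$ is the infimum of all constants $c$ such that $A(I) \le c\,\textsc{Opt}_A(I)$ for all inputs $I$. *)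

theory Defs
  imports Complex_Main "HOL-Library.Extended_Real"
begin

text \<open>
  An input of type \<open>'r list\<close> is a sequence of requests, each of which is answered by a
  decision of type \<open>'d\<close>. A deterministic online algorithm maps the earlier requests, its own
  earlier decisions and the current request to a decision.
\<close>

type_synonym ('r, 'd) online_alg = "'r list \<Rightarrow> 'd list \<Rightarrow> 'r \<Rightarrow> 'd"

primrec run_from :: "('r, 'd) online_alg \<Rightarrow> 'r list \<Rightarrow> 'd list \<Rightarrow> 'r list \<Rightarrow> 'd list" where
  "run_from A rs ds [] = ds"
| "run_from A rs ds (r # I) = run_from A (rs @ [r]) (ds @ [A rs ds r]) I"

definition run :: "('r, 'd) online_alg \<Rightarrow> 'r list \<Rightarrow> 'd list" where
  "run A I = run_from A [] [] I"

definition alg_cost :: "('r list \<Rightarrow> 'd list \<Rightarrow> real) \<Rightarrow> ('r, 'd) online_alg \<Rightarrow> 'r list \<Rightarrow> real" where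
  "alg_cost cost A I = cost I (run A I)"

definition bounded_solutions ::
  "('r list \<Rightarrow> 'd list \<Rightarrow> real) \<Rightarrow> ('r, 'd) online_alg \<Rightarrow> 'r list \<Rightarrow> 'd list set" where
  "bounded_solutions cost A I =
     {ds. length ds = length I \<and>
          (\<forall>k\<le>length I. cost (take k I) (take k ds) \<le> alg_cost cost A (take k I))}"

text \<open>
  The minimum is over a finite nonempty set: see \<open>finite_bounded_solutions\<close> and
  \<open>run_in_bounded_solutions\<close> below.
\<close>

definition opt_cost ::
  "('r list \<Rightarrow> 'd::finite list \<Rightarrow> real) \<Rightarrow> ('r, 'd) online_alg \<Rightarrow> 'r list \<Rightarrow> real" where
  "opt_cost cost A I = Min (cost I ` bounded_solutions cost A I)"

text \<open>
  The infimum is taken in the extended reals, so that it is \<open>\<infinity>\<close> if no constant works.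
\<close>

definition online_bounded_ratio ::
  "('r list \<Rightarrow> 'd::finite list \<Rightarrow> real) \<Rightarrow> 'r list set \<Rightarrow> ('r, 'd) online_alg \<Rightarrow> ereal" where
  "online_bounded_ratio cost inputs A =
     Inf (ereal ` {c. \<forall>I\<in>inputs. alg_cost cost A I \<le> c * opt_cost cost A I})"

lemma length_run_from: "length (run_from A rs ds I) = length ds + length I"
  by (induction I arbitrary: rs ds) auto

lemma take_run_from:
  "take (length ds + k) (run_from A rs ds I) = run_from A rs ds (take k I)"
proof (induction I arbitrary: rs ds k)
  case Nil
  then show ?case by simp
next
  case (Cons r I)
  show ?case
  proof (cases k)
    case 0
    have "take (length ds) (run_from A rs' (ds @ ds') I') = ds" for rs' ds' I'
      by (induction I' arbitrary: rs' ds') auto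
    then show ?thesis using 0 by simp
  next
    case (Suc k')
    then show ?thesis
      using Cons.IH[of "ds @ [A rs ds r]" k' "rs @ [r]"] by simp
  qed
qed

lemma run_in_bounded_solutions: "run A I \<in> bounded_solutions cost A I"
  using take_run_from[of "[]" _ A "[]" I]
  by (simp add: bounded_solutions_def alg_cost_def run_def length_run_from)

lemma finite_bounded_solutions:
  fixes A :: "('r, 'd::finite) online_alg"
  shows "finite (bounded_solutions cost A I)"
  by (rule finite_subset[OF _ finite_lists_length_eq[OF finite[of UNIV], of "length I"]])
     (auto simp: bounded_solutions_def)

datatype machine = M1 | M2

instance machine :: finite
proof
  have "(UNIV :: machine set) = {M1, M2}"
    using machine.exhaust by auto
  then show "finite (UNIV :: machine set)"
    by (metis finite.emptyI finite.insertI)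
qed

definition load :: "real list \<Rightarrow> machine list \<Rightarrow> machine \<Rightarrow> real" where
  "load ps ds m = (\<Sum>(p, d) \<leftarrow> zip ps ds. if d = m then p else 0)"

definition makespan :: "real \<Rightarrow> real list \<Rightarrow> machine list \<Rightarrow> real" where
  "makespan s ps ds = max (load ps ds M1 / s) (load ps ds M2)"

definition job_inputs :: "real list set" where
  "job_inputs = {ps. \<forall>p\<in>set ps. p > 0}"

definition greedy :: "real \<Rightarrow> (real, machine) online_alg" where
  "greedy s ps ds p =
     (if makespan s (ps @ [p]) (ds @ [M2]) \<le> makespan s (ps @ [p]) (ds @ [M1]) then M2 else M1)"

end

theory Submission
  imports Defs
begin

text \<open>
  A bounded solution keeps a rigid relation to \textsc{Greedy}: at every prefix the two either have
  the same loads, or they have the same makespan \<open>T\<close>, attained by \textsc{Greedy} on machine 2 and by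
  the bounded solution on machine 1. The second situation arises only from a tie. While it lasts,
  \textsc{Greedy} fills machine 1, and the bounded solution has to put the same jobs on machine 2.
  When a job raises \textsc{Greedy}'s makespan above \<open>T\<close>, the excess volume costs \textsc{Greedy}
  only a fraction \<open>1 / s\<close> of what it would cost on machine 2, so no bounded solution can follow
  unless the loads have become equal again. Hence the makespans agree at every prefix.
\<close>

lemma run_from_snoc:
  "run_from A rs ds (I @ [r]) =
     run_from A rs ds I @ [A (rs @ I) (run_from A rs ds I) r]"
  by (induction I arbitrary: rs ds) auto

lemma run_snoc: "run A (I @ [r]) = run A I @ [A I (run A I) r]"
  by (simp add: run_def run_from_snoc)

lemma length_run: "length (run A I) = length I"
  by (simp add: run_def length_run_from)

text \<open>The bound is imposed at every prefix, so dropping the last decision leaves a bounded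
  solution of the shorter input. This drives the induction on the last job.\<close>

lemma bounded_solutions_snocE:
  assumes "ds \<in> bounded_solutions cost A (I @ [r])"
  obtains ds' d where "ds = ds' @ [d]" "ds' \<in> bounded_solutions cost A I"
    "cost (I @ [r]) (ds' @ [d]) \<le> alg_cost cost A (I @ [r])"
proof -
  have len: "length ds = Suc (length I)"
    and bnd: "\<And>k. k \<le> Suc (length I) \<Longrightarrow>
      cost (take k (I @ [r])) (take k ds) \<le> alg_cost cost A (take k (I @ [r]))"
    using assms by (auto simp: bounded_solutions_def)
  obtain ds' d where ds: "ds = ds' @ [d]"
    using len by (metis length_Suc_conv_rev)
  with len have len': "length ds' = length I" by simp
  have "ds' \<in> bounded_solutions cost A I"
    unfolding bounded_solutions_def
  proof (intro CollectI conjI allI impI len')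
    fix k assume "k \<le> length I"
    then show "cost (take k I) (take k ds') \<le> alg_cost cost A (take k I)"
      using bnd[of k] len' by (simp add: ds)
  qed
  moreover have "cost (I @ [r]) (ds' @ [d]) \<le> alg_cost cost A (I @ [r])"
    using bnd[of "Suc (length I)"] len' by (simp add: ds)
  ultimately show thesis using that ds by blast
qed

lemma length_bounded_solutions:
  "ds \<in> bounded_solutions cost A I \<Longrightarrow> length ds = length I"
  by (simp add: bounded_solutions_def)

lemma load_Nil [simp]: "load [] ds m = 0"
  by (simp add: load_def)

lemma load_snoc:
  "length ps = length ds \<Longrightarrow>
    load (ps @ [p]) (ds @ [d]) m = load ps ds m + (if d = m then p else 0)"
  by (simp add: load_def)

text \<open>The loads of \textsc{Greedy} are \<open>g1\<close> and \<open>g2\<close>, those of the bounded solution \<open>b1\<close> and \<open>b2\<close>.\<close>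

definition coupled :: "real \<Rightarrow> real \<Rightarrow> real \<Rightarrow> real \<Rightarrow> real \<Rightarrow> bool" where
  "coupled s g1 g2 b1 b2 \<longleftrightarrow>
     g1 + g2 = b1 + b2 \<and> (g1 = b1 \<or> s * g2 = b1 \<and> g1 \<le> b1)"

text \<open>If \<open>g1\<close> and \<open>b1\<close> differ, both maxima are \<open>g2\<close>:
  \<open>g1 \<le> b1 = s * g2\<close>, and equal totals then give
  \<open>b2 \<le> g2\<close>.\<close>

lemma coupled_makespan_eq:
  assumes "s > 1" "g2 \<ge> 0" "coupled s g1 g2 b1 b2"
  shows "max (g1 / s) g2 = max (b1 / s) b2"
proof (cases "g1 = b1")
  case True
  then show ?thesis using assms by (simp add: coupled_def)
next
  case False
  then have b1: "b1 = s * g2" and "g1 \<le> b1" and tot: "g1 + g2 = b1 + b2"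
    using assms by (auto simp: coupled_def)
  have "g1 / s \<le> g2" "b1 / s = g2"
    using assms b1 \<open>g1 \<le> b1\<close> by (auto simp: field_simps)
  moreover have "b2 \<le> g2" using tot \<open>g1 \<le> b1\<close> by simp
  ultimately show ?thesis by simp
qed

lemma coupled_step:
  fixes s p :: real
  defines "m \<equiv> \<lambda>x y. max (x / s) y"
  assumes s: "s > 1" and p: "p > 0" and "coupled s g1 g2 b1 b2"
    and greedy: "(g1', g2') =
      (if m g1 (g2 + p) \<le> m (g1 + p) g2 then (g1, g2 + p) else (g1 + p, g2))"
    and move: "(b1', b2') = (b1 + p, b2) \<or> (b1', b2') = (b1, b2 + p)"
    and le: "m b1' b2' \<le> m g1' g2'"
  shows "coupled s g1' g2' b1' b2'"
proof (cases "g1 = b1")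
  case True
  then have eq: "b1 = g1" "b2 = g2"
    using assms by (auto simp: coupled_def)
  have lt: "g1 / s < (g1 + p) / s" using s p by (simp add: divide_strict_right_mono)
  show ?thesis
  proof (cases "(b1', b2') = (g1', g2')")
    case True
    then show ?thesis by (simp add: coupled_def)
  next
    case False
    \<comment> \<open>Had Greedy chosen machine 1, machine 2 would be strictly worse, against
      \<open>le\<close>. So Greedy chose machine 2, and \<open>le\<close> makes this a tie.\<close>
    have *: "g1' = g1" "g2' = g2 + p" "b1' = g1 + p" "b2' = g2"
      and "m g1 (g2 + p) = m (g1 + p) g2"
      using False greedy move le eq by (auto split: if_splits)
    \<comment> \<open>The job strictly raises its machine's completion time, so each of the tied
      maxima is attained where the job went.\<close>
    then have "(g1 + p) / s = g2 + p"
      using lt p unfolding m_def by (auto simp: max_def split: if_splits)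
    then have "s * (g2 + p) = g1 + p" using s by (simp add: field_simps)
    then show ?thesis using * p by (simp add: coupled_def)
  qed
next
  case False
  then have b1: "b1 = s * g2" and le1: "g1 \<le> b1" and tot: "g1 + g2 = b1 + b2"
    using assms by (auto simp: coupled_def)
  \<comment> \<open>Since \<open>g1 \<le> s * g2\<close>, Greedy strictly prefers the fast
    machine.\<close>
  have "(g1 + p) / s < g2 + p"
  proof -
    have "p < s * p" using s p by simp
    then show ?thesis using s le1 b1 by (simp add: field_simps)
  qed
  then have g: "g1' = g1 + p" "g2' = g2"
    using greedy p unfolding m_def by (auto split: if_splits)
  have b1s: "b1 / s = g2" "(b1 + p) / s = g2 + p / s" using s b1 by (auto simp: field_simps)
  have ps: "p / s > 0" using s p by simp
  from move show ?thesis
  proof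
    \<comment> \<open>The value \<open>g2 + p / s\<close> exceeds \<open>g2\<close>, so only
      Greedy's machine 1 can dominate it.\<close>
    assume b: "(b1', b2') = (b1 + p, b2)"
    then have "(b1 + p) / s \<le> (g1 + p) / s"
      using le g b1s ps unfolding m_def by auto
    then have "b1 \<le> g1" using s by (simp add: divide_le_cancel)
    then show ?thesis using False le1 by simp
  next
    assume b: "(b1', b2') = (b1, b2 + p)"
    have "g1 + p \<le> b1"
    proof (rule ccontr)
      assume "\<not> g1 + p \<le> b1"
      \<comment> \<open>The excess \<open>g1 + p - b1\<close> adds to \<open>g2\<close> in full on
        the bounded solution's machine 2, but only divided by \<open>s\<close> on Greedy's machine
        1.\<close>
      then have x: "g1 + p - b1 > 0" by simp
      then have "(g1 + p - b1) / s < g1 + p - b1" using s by (simp add: divide_less_eq)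
      moreover have "(g1 + p) / s = g2 + (g1 + p - b1) / s"
        using b1s by (simp add: diff_divide_distrib)
      moreover have "b2 + p = g2 + (g1 + p - b1)" using tot by simp
      ultimately have "(g1 + p) / s < b2 + p" "g2 < b2 + p" using x by linarith+
      then show False using le g b unfolding m_def by auto
    qed
    then show ?thesis using g b b1 tot by (simp add: coupled_def)
  qed
qed

lemma load_nonneg: "ps \<in> job_inputs \<Longrightarrow> 0 \<le> load ps ds m"
  unfolding load_def
  by (rule sum_list_nonneg) (auto simp: job_inputs_def dest!: set_zip_leftD less_imp_le)

lemma coupled_greedy:
  assumes "s > 1" "ps \<in> job_inputs"
    and "ds \<in> bounded_solutions (makespan s) (greedy s) ps"
  defines "gs \<equiv> run (greedy s) ps"
  shows "coupled s (load ps gs M1) (load ps gs M2) (load ps ds M1) (load ps ds M2)"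
  using assms(2,3) unfolding gs_def
proof (induction ps arbitrary: ds rule: rev_induct)
  case Nil
  then show ?case by (simp add: coupled_def)
next
  case (snoc p ps)
  let ?g = "run (greedy s) ps"
  have p: "p > 0" and ps: "ps \<in> job_inputs"
    using snoc.prems(1) by (auto simp: job_inputs_def)
  obtain ds' d where ds: "ds = ds' @ [d]"
    and ds': "ds' \<in> bounded_solutions (makespan s) (greedy s) ps"
    and le: "makespan s (ps @ [p]) (ds' @ [d]) \<le> alg_cost (makespan s) (greedy s) (ps @ [p])"
    using snoc.prems(2) by (rule bounded_solutions_snocE)
  have len: "length ps = length ?g" "length ps = length ds'"
    using length_bounded_solutions[OF ds'] by (simp_all add: length_run)
  show ?case unfolding ds
  proof (rule coupled_step[OF \<open>s > 1\<close> p snoc.IH[OF ps ds']])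
    show "max (load (ps @ [p]) (ds' @ [d]) M1 / s) (load (ps @ [p]) (ds' @ [d]) M2)
      \<le> max (load (ps @ [p]) (run (greedy s) (ps @ [p])) M1 / s)
          (load (ps @ [p]) (run (greedy s) (ps @ [p])) M2)"
      using le by (simp add: alg_cost_def makespan_def)
    show "(load (ps @ [p]) (ds' @ [d]) M1, load (ps @ [p]) (ds' @ [d]) M2) =
        (load ps ds' M1 + p, load ps ds' M2) \<or>
      (load (ps @ [p]) (ds' @ [d]) M1, load (ps @ [p]) (ds' @ [d]) M2) =
        (load ps ds' M1, load ps ds' M2 + p)"
      using len by (cases d) (auto simp: load_snoc)
  qed (use len in \<open>simp add: run_snoc load_snoc makespan_def greedy_def[of s ps ?g p]\<close>)
qed

lemma opt_cost_greedy:
  assumes "s > 1" "ps \<in> job_inputs"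
  shows "opt_cost (makespan s) (greedy s) ps = alg_cost (makespan s) (greedy s) ps"
proof -
  have "makespan s ps ds = makespan s ps (run (greedy s) ps)"
    if "ds \<in> bounded_solutions (makespan s) (greedy s) ps" for ds
    using coupled_makespan_eq[OF assms(1) load_nonneg coupled_greedy] assms that
    by (simp add: makespan_def)
  then have "makespan s ps ` bounded_solutions (makespan s) (greedy s) ps =
      {makespan s ps (run (greedy s) ps)}"
    using run_in_bounded_solutions[of "greedy s" ps "makespan s"] by blast
  then show ?thesis by (simp add: opt_cost_def alg_cost_def)
qed

theorem theorem3:
  fixes s :: real
  assumes "s > 1"
  shows "online_bounded_ratio (makespan s) job_inputs (greedy s) = 1"
proof -
  let ?C = "{c. \<forall>ps\<in>job_inputs.
    alg_cost (makespan s) (greedy s) ps \<le> c * opt_cost (makespan s) (greedy s) ps}"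
  have "1 \<in> ?C" using opt_cost_greedy[OF assms] by simp
  moreover have "1 \<le> c" if "c \<in> ?C" for c
  proof -
    \<comment> \<open>One job with positive cost, equal to its bounded optimum, excludes every
      \<open>c < 1\<close>.\<close>
    have one: "[1] \<in> job_inputs" by (simp add: job_inputs_def)
    have "0 < makespan s [1] [d]" for d
      using assms by (cases d) (auto simp: makespan_def load_def less_max_iff_disj)
    then have "0 < alg_cost (makespan s) (greedy s) [1]"
      by (simp add: alg_cost_def run_def)
    moreover have "alg_cost (makespan s) (greedy s) [1]
        \<le> c * alg_cost (makespan s) (greedy s) [1]"
      using that one opt_cost_greedy[OF assms one] by force
    ultimately show ?thesis by simp
  qed
  ultimately have "Inf (ereal ` ?C) = 1"
    by (intro antisym Inf_greatest Inf_lower) (auto simp: one_ereal_def)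
  then show ?thesis by (simp add: online_bounded_ratio_def)
qed

end
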